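(* Let $X$ be a compact metric space. Then $\mathcal{M}_{v1}(X)$ is separable and metrizable, and $\mathcal{M}_{v2}(X)$ is separable and metrizable.
   Context: For a topological space $X$ with Borel $\sigma$-algebra $\mathcal{B}$, $\mathcal{M}(X)$ denotes the set of all probability measures on $(X,\mathcal{B})$. A function $f:X\to\mathbb{R}$ vanishes at infinity if $f^{-1}((-\infty,-\epsilon]\cup[\epsilon,\infty))$ is compact for every $\epsilon>0$; its support is the closure of $\{x: f(x)\neq 0\}$. $C_{sc}(X)$ is the set of continuous functions $X\to\mathbb{R}$ with compact support, and $C_0(X)$ is the set of continuous functions $X\to\mathbb{R}$ vanishing at infinity. For $\nu\in\mathcal{M}(X)$, a function $f$ and $\epsilon>0$ put $W(\nu,f,\epsilon)=\{\varrho\in\mathcal{M}(X): |\int_X f\,d\varrho-\int_X f\,d\nu|<\epsilon\}$. $\mathcal{M}_{v1}(X)$ is $\mathcal{M}(X)$ with the Type-I vague topology, generated (as a subbasis) by all $W(\nu,f,\epsilon)$ with $\nu\in\mathcal{M}(X)$, $f\in C_{sc}(X)$, $\epsilon>0$. $\mathcal{M}_{v2}(X)$ is $\mathcal{M}(X)$ with the Type-II vague topology, generated (as a subbasis) by all $W(\nu,f,\epsilon)$ with $\nu\in\mathcal{M}(X)$, $f\in C_0(X)$, $\epsilon>0$. *)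

theory Defs
  imports "HOL-Probability.Probability"
begin

text \<open>
  A function on a space \<open>X\<close> is represented by a total function on the underlying type; its values
  outside \<open>topspace X\<close> are irrelevant to every notion below.
\<close>

definition borel_of :: "'a topology \<Rightarrow> 'a measure" where
  "borel_of X = sigma (topspace X) {U. openin X U}"

definition prob_measures :: "'a topology \<Rightarrow> 'a measure set" where
  "prob_measures X = {\<mu>. prob_space \<mu> \<and> sets \<mu> = sets (borel_of X)}"

definition vanishes_at_infinity :: "'a topology \<Rightarrow> ('a \<Rightarrow> real) \<Rightarrow> bool" where
  "vanishes_at_infinity X f \<longleftrightarrow>
     (\<forall>\<epsilon>>0. compactin X (topspace X \<inter> f -` ({..-\<epsilon>} \<union> {\<epsilon>..})))"

definition support_of :: "'a topology \<Rightarrow> ('a \<Rightarrow> real) \<Rightarrow> 'a set" where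
  "support_of X f = X closure_of {x \<in> topspace X. f x \<noteq> 0}"

definition C_sc :: "'a topology \<Rightarrow> ('a \<Rightarrow> real) set" where
  "C_sc X = {f. continuous_map X euclideanreal f \<and> compactin X (support_of X f)}"

definition C_0 :: "'a topology \<Rightarrow> ('a \<Rightarrow> real) set" where
  "C_0 X = {f. continuous_map X euclideanreal f \<and> vanishes_at_infinity X f}"

definition vague_nbhd :: "'a topology \<Rightarrow> 'a measure \<Rightarrow> ('a \<Rightarrow> real) \<Rightarrow> real \<Rightarrow> 'a measure set" where
  "vague_nbhd X \<nu> f \<epsilon> =
     {\<rho> \<in> prob_measures X. \<bar>(\<integral>x. f x \<partial>\<rho>) - (\<integral>x. f x \<partial>\<nu>)\<bar> < \<epsilon>}"

definition vague1_topology :: "'a topology \<Rightarrow> 'a measure topology" where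
  "vague1_topology X = topology_generated_by
     {vague_nbhd X \<nu> f \<epsilon> | \<nu> f \<epsilon>. \<nu> \<in> prob_measures X \<and> f \<in> C_sc X \<and> \<epsilon> > 0}"

definition vague2_topology :: "'a topology \<Rightarrow> 'a measure topology" where
  "vague2_topology X = topology_generated_by
     {vague_nbhd X \<nu> f \<epsilon> | \<nu> f \<epsilon>. \<nu> \<in> prob_measures X \<and> f \<in> C_0 X \<and> \<epsilon> > 0}"

text \<open>
  \<open>topology_generated_by\<close> takes the union of the subbasis as the carrier; since the zero function
  is a test function, this union is the whole set of probability measures.
\<close>

lemma vague_nbhd_subset: "vague_nbhd X \<nu> f \<epsilon> \<subseteq> prob_measures X"
  unfolding vague_nbhd_def by (rule Collect_restrict)

lemma in_vague_nbhd: "\<nu> \<in> prob_measures X \<Longrightarrow> \<epsilon> > 0 \<Longrightarrow> \<nu> \<in> vague_nbhd X \<nu> f \<epsilon>"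
  by (simp add: vague_nbhd_def)

lemma zero_in_C_sc: "(\<lambda>x. 0) \<in> C_sc X"
  by (simp add: C_sc_def support_of_def)

lemma zero_in_C_0: "(\<lambda>x. 0) \<in> C_0 X"
proof -
  have "topspace X \<inter> (\<lambda>x. 0) -` ({..-\<epsilon>} \<union> {\<epsilon>..}) = {}" if "\<epsilon> > 0" for \<epsilon> :: real
    using that by auto
  then show ?thesis
    by (simp add: C_0_def vanishes_at_infinity_def)
qed

lemma Union_vague_nbhd:
  assumes "(\<lambda>x. 0) \<in> F"
  shows "\<Union>{vague_nbhd X \<nu> f \<epsilon> | \<nu> f \<epsilon>. \<nu> \<in> prob_measures X \<and> f \<in> F \<and> \<epsilon> > 0} = prob_measures X"
    (is "\<Union>?S = _")
proof (rule equalityI)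
  show "\<Union>?S \<subseteq> prob_measures X"
    by (rule Union_least) (use vague_nbhd_subset in fast)
next
  show "prob_measures X \<subseteq> \<Union>?S"
  proof (rule subsetI)
    fix \<nu> assume \<nu>: "\<nu> \<in> prob_measures X"
    have "\<nu> \<in> vague_nbhd X \<nu> (\<lambda>x. 0) 1"
      by (rule in_vague_nbhd) (use \<nu> in simp_all)
    moreover have "vague_nbhd X \<nu> (\<lambda>x. 0) 1 \<in> ?S"
      using \<nu> assms zero_less_one by (intro CollectI exI conjI) (rule refl)
    ultimately show "\<nu> \<in> \<Union>?S"
      by (rule UnionI[rotated])
  qed
qed

lemma topspace_vague1_topology: "topspace (vague1_topology X) = prob_measures X"
  unfolding vague1_topology_def topology_generated_by_topspace
  by (rule Union_vague_nbhd[OF zero_in_C_sc])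

lemma topspace_vague2_topology: "topspace (vague2_topology X) = prob_measures X"
  unfolding vague2_topology_def topology_generated_by_topspace
  by (rule Union_vague_nbhd[OF zero_in_C_0])

end

theory Submission
  imports Defs
begin

text \<open>
  On a compact space both classes of test functions consist of all continuous functions, so the two
  topologies coincide. The continuous functions have a countable subset \<open>{g\<^sub>0, g\<^sub>1, \<dots>}\<close> that is dense for
  the supremum norm, and the map \<open>\<mu> \<mapsto> (\<integral>g\<^sub>n d\<mu>)\<^sub>n\<close> is then an embedding into the space of real
  sequences with the product topology, which is second countable and metrizable. Injectivity holds
  because the indicator of a closed set, being a \<open>G\<^sub>\<delta>\<close>, is a bounded pointwise limit of Urysohn
  functions.
\<close>

section \<open>Test functions on a compact space\<close>

text \<open>A support is a closure, hence closed, and closed subsets of a compact space are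
  compact.\<close>

lemma C_sc_compact_space:
  assumes "compact_space X"
  shows "C_sc X = {f. continuous_map X euclideanreal f}"
  unfolding C_sc_def support_of_def
  using assms closedin_compact_space closedin_closure_of by blast

lemma C_0_compact_space:
  assumes "compact_space X"
  shows "C_0 X = {f. continuous_map X euclideanreal f}"
proof -
  have "vanishes_at_infinity X f" if f: "continuous_map X euclideanreal f" for f
    unfolding vanishes_at_infinity_def
  proof (intro allI impI)
    fix \<epsilon> :: real
    have "closedin X {x \<in> topspace X. f x \<in> {..-\<epsilon>} \<union> {\<epsilon>..}}"
      by (rule closedin_continuous_map_preimage[OF f]) auto
    moreover have "{x \<in> topspace X. f x \<in> {..-\<epsilon>} \<union> {\<epsilon>..}} = topspace X \<inter> f -` ({..-\<epsilon>} \<union> {\<epsilon>..})"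
      by auto
    ultimately show "compactin X (topspace X \<inter> f -` ({..-\<epsilon>} \<union> {\<epsilon>..}))"
      using assms closedin_compact_space by metis
  qed
  then show ?thesis
    unfolding C_0_def by blast
qed

section \<open>Embeddings and pullback topologies\<close>

text \<open>The image of the trace on \<open>A\<close> of the preimage of \<open>U\<close> is
  \<open>U \<inter> f\<close> followed by the image of \<open>A\<close>, so \<open>f\<close> is open
  onto its image. The assumption \<open>im\<close> makes the carrier of the pullback all of
  \<open>A\<close>.\<close>

lemma embedding_map_pullback_topology:
  assumes inj: "inj_on f A" and im: "f ` A \<subseteq> topspace T"
  shows "embedding_map (pullback_topology A f T) T f"
proof -
  let ?P = "pullback_topology A f T"
  have top: "topspace ?P = A"
    using im by (auto simp: topspace_pullback_topology)
  have "continuous_map ?P T (id \<circ> f)"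
    by (rule continuous_map_pullback) simp
  then have cont: "continuous_map ?P (subtopology T (f ` A)) f"
    by (simp add: continuous_map_in_subtopology top)
  have "open_map ?P (subtopology T (f ` A)) f"
    unfolding open_map_def
  proof (intro allI impI)
    fix S assume "openin ?P S"
    then obtain U where "openin T U" "S = f -` U \<inter> A"
      by (auto simp: openin_pullback_topology)
    moreover from this have "f ` S = U \<inter> f ` A"
      by auto
    ultimately show "openin (subtopology T (f ` A)) (f ` S)"
      by (auto simp: openin_subtopology)
  qed
  with cont inj show ?thesis
    using injective_open_imp_embedding_map embedding_map_in_subtopology top by metis
qed

lemma second_countable_euclidean:
  "second_countable (euclidean :: 'a::second_countable_topology topology)"
proof -
  obtain B :: "'a set set" where "countable B" "topological_basis B"
    using ex_countable_basis by blast
  then show ?thesis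
    unfolding second_countable_def
    by (metis open_openin topological_basisE topological_basis_open)
qed

text \<open>Separability need not pass to subspaces, so it is obtained from second countability,
  which does.\<close>

lemma embedding_map_separable_metrizable:
  fixes \<Phi> :: "'a \<Rightarrow> nat \<Rightarrow> real"
  assumes "embedding_map T euclidean \<Phi>"
  shows "separable_space T" and "metrizable_space T"
proof -
  let ?E = "subtopology euclidean (\<Phi> ` topspace T)"
  have hom: "T homeomorphic_space ?E"
    by (rule embedding_map_imp_homeomorphic_space[OF assms])
  have "second_countable ?E" "metrizable_space ?E"
    by (simp_all add: second_countable_subtopology second_countable_euclidean
        metrizable_space_subtopology metrizable_space_euclidean)
  with hom show "separable_space T" "metrizable_space T"
    using homeomorphic_space_second_countability second_countable_imp_separable_space
      homeomorphic_metrizable_space by blast+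
qed

section \<open>A countable uniformly dense set of continuous functions\<close>

text \<open>Compactness enters twice: total boundedness supplies the finite nets \<open>K n\<close>,
  and uniform continuity of \<open>f\<close> lets its values on a fine net determine it up to a
  small error.\<close>

lemma (in Metric_space) countable_uniformly_dense_continuous:
  assumes "compact_space mtopology"
  obtains G where "countable G" "G \<subseteq> {g. continuous_map mtopology euclideanreal g}"
    "\<And>f \<epsilon>. continuous_map mtopology euclideanreal f \<Longrightarrow> \<epsilon> > 0 \<Longrightarrow>
       \<exists>g\<in>G. \<forall>x\<in>M. \<bar>g x - f x\<bar> \<le> \<epsilon>"
proof -
  have "mtotally_bounded M"
    using assms compactin_imp_mtotally_bounded by (simp add: compact_space_def)
  then have "\<exists>K. finite K \<and> K \<subseteq> M \<and> M \<subseteq> (\<Union>y\<in>K. mball y (1 / Suc n))" for n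
    unfolding mtotally_bounded_def by simp
  then obtain K where K: "\<And>n. finite (K n)" "\<And>n. K n \<subseteq> M"
    "\<And>n. M \<subseteq> (\<Union>y\<in>K n. mball y (1 / Suc n))"
    by metis
  \<comment> \<open>The normalised bumps \<open>\<phi> n y\<close> form a partition of unity subordinate to the balls of radius
    \<open>1 / Suc n\<close>; combining them with rational coefficients gives the dense set.\<close>
  define \<phi> where "\<phi> n y x = max 0 (1 / Suc n - d y x)" for n y x
  define g where "g n q x = (\<Sum>y\<in>K n. q y * \<phi> n y x) / (\<Sum>y\<in>K n. \<phi> n y x)" for n x and q :: "'a \<Rightarrow> real"
  define G where "G = (\<Union>n. g n ` (PiE (K n) (\<lambda>_. \<rat>)))"
  have \<phi>_nonneg: "\<phi> n y x \<ge> 0" for n y x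
    by (simp add: \<phi>_def)
  have \<phi>_sum_pos: "(\<Sum>y\<in>K n. \<phi> n y x) > 0" if "x \<in> M" for n x
  proof -
    obtain y where "y \<in> K n" "x \<in> mball y (1 / Suc n)"
      using K(3)[of n] \<open>x \<in> M\<close> by blast
    then have "y \<in> K n" "\<phi> n y x > 0"
      by (auto simp: \<phi>_def)
    with K(1) \<phi>_nonneg show ?thesis
      by (meson sum_pos2)
  qed
  have \<phi>_cont: "continuous_map mtopology euclideanreal (\<phi> n y)" if "y \<in> M" for n y
  proof -
    have "continuous_map mtopology euclideanreal (d y)"
      using continuous_on_mdist[of y "metric (M, d)"] that
      by (simp add: mtopology_of_def)
    then show ?thesis
      unfolding \<phi>_def by (intro continuous_intros) auto
  qed
  have g_cont: "continuous_map mtopology euclideanreal (g n q)" for n q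
    unfolding g_def
    using K \<phi>_cont \<phi>_sum_pos
    by (intro continuous_intros) (auto simp: subset_iff less_imp_neq[symmetric])
  have dense: "\<exists>h\<in>G. \<forall>x\<in>M. \<bar>h x - f x\<bar> \<le> \<epsilon>"
    if f: "continuous_map mtopology euclideanreal f" and "\<epsilon> > 0" for f \<epsilon>
  proof -
    have "uniformly_continuous_map (metric (M, d)) euclidean_metric f"
      using assms f by (intro continuous_imp_uniformly_continuous_map)
        (simp_all add: mtopology_of_def)
    then obtain \<delta> where "\<delta> > 0"
      and \<delta>: "\<And>x y. x \<in> M \<Longrightarrow> y \<in> M \<Longrightarrow> d y x < \<delta> \<Longrightarrow> \<bar>f y - f x\<bar> < \<epsilon> / 2"
      using \<open>\<epsilon> > 0\<close> unfolding uniformly_continuous_map_def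
      by (force simp: dist_real_def dest: spec[where x = "\<epsilon>/2"])
    obtain n where n: "1 / real (Suc n) < \<delta>"
      using \<open>\<delta> > 0\<close> nat_approx_posE by blast
    have "\<exists>r\<in>\<rat>. \<bar>r - f y\<bar> < \<epsilon> / 2" for y
      using Rats_dense_in_real[of "f y" "f y + \<epsilon> / 2"] \<open>\<epsilon> > 0\<close> by force
    then obtain q0 where q0: "\<And>y. q0 y \<in> \<rat>" "\<And>y. \<bar>q0 y - f y\<bar> < \<epsilon> / 2"
      by metis
    \<comment> \<open>The restriction makes the coefficients extensional, as membership in
      \<open>PiE\<close> demands. Fixing them off the finite set \<open>K n\<close> is what keeps
      \<open>G\<close> countable.\<close>
    define q where "q = restrict q0 (K n)"
    have "\<bar>g n q x - f x\<bar> \<le> \<epsilon>" if "x \<in> M" for x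
    proof -
      let ?S = "\<Sum>y\<in>K n. \<phi> n y x"
      note S = \<phi>_sum_pos[OF \<open>x \<in> M\<close>, of n]
      \<comment> \<open>The weights \<open>\<phi> n y x / ?S\<close> sum to one, so the error is an
        average of the differences \<open>q y - f x\<close>.\<close>
      have "g n q x - f x = (\<Sum>y\<in>K n. (q y - f x) * \<phi> n y x) / ?S"
        using S by (simp add: g_def field_simps sum_subtractf sum_distrib_left sum_distrib_right)
      then have "\<bar>g n q x - f x\<bar> = \<bar>\<Sum>y\<in>K n. (q y - f x) * \<phi> n y x\<bar> / ?S"
        using S by simp
      also have "\<dots> \<le> (\<Sum>y\<in>K n. \<epsilon> * \<phi> n y x) / ?S"
      proof (intro divide_right_mono order.trans[OF sum_abs] sum_mono)
        fix y assume y: "y \<in> K n"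
        show "\<bar>(q y - f x) * \<phi> n y x\<bar> \<le> \<epsilon> * \<phi> n y x"
        \<comment> \<open>Only centres within \<open>1 / Suc n\<close> of \<open>x\<close> carry
          weight. For them half of \<epsilon> pays for moving from \<open>y\<close> to
          \<open>x\<close>, the other half for the rational rounding of \<open>f y\<close>.\<close>
        proof (cases "\<phi> n y x = 0")
          case False
          then have "d y x < \<delta>"
            using n by (auto simp: \<phi>_def max_def split: if_splits)
          then have "\<bar>f y - f x\<bar> < \<epsilon> / 2"
            using \<delta> y K(2) \<open>x \<in> M\<close> by blast
          moreover have "\<bar>q y - f y\<bar> < \<epsilon> / 2"
            using q0(2) y by (simp add: q_def)
          ultimately have "\<bar>q y - f x\<bar> \<le> \<epsilon>"
            by linarith
          then show ?thesis
            using \<phi>_nonneg[of n y x] by (simp add: abs_mult mult_right_mono)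
        qed simp
      qed (use S in simp)
      also have "\<dots> = \<epsilon>"
        using S by (simp flip: sum_distrib_left)
      finally show ?thesis .
    qed
    moreover have "q \<in> PiE (K n) (\<lambda>_. \<rat>)"
      using q0(1) by (simp add: q_def)
    then have "g n q \<in> G"
      unfolding G_def by blast
    ultimately show ?thesis
      by blast
  qed
  show thesis
  proof (rule that[of G])
    show "countable G"
      unfolding G_def using K(1) by (intro countable_UN countable_image countable_PiE) (auto simp: countable_rat)
    show "G \<subseteq> {g. continuous_map mtopology euclideanreal g}"
      using g_cont by (auto simp: G_def)
  qed (use dense in blast)
qed

section \<open>Borel probability measures and integrals of continuous functions\<close>

lemma space_borel_of: "space (borel_of X) = topspace X"
  by (simp add: borel_of_def space_measure_of_conv)

lemma sets_borel_of: "sets (borel_of X) = sigma_sets (topspace X) {U. openin X U}"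
  unfolding borel_of_def by (rule sets_measure_of) (auto dest: openin_subset)

lemma prob_measuresD:
  assumes "\<mu> \<in> prob_measures X"
  shows "prob_space \<mu>" "sets \<mu> = sigma_sets (topspace X) {U. openin X U}" "space \<mu> = topspace X"
  using assms sets_eq_imp_space_eq[of \<mu> "borel_of X"]
  by (auto simp: prob_measures_def space_borel_of sets_borel_of)

lemma continuous_map_borel_measurable:
  assumes "\<mu> \<in> prob_measures X" "continuous_map X euclideanreal f"
  shows "f \<in> borel_measurable \<mu>"
proof (rule borel_measurableI)
  fix S :: "real set" assume "open S"
  then have "openin X {x \<in> topspace X. f x \<in> S}"
    using assms(2) openin_continuous_map_preimage by fastforce
  moreover have "{x \<in> topspace X. f x \<in> S} = f -` S \<inter> space \<mu>"
    using prob_measuresD(3)[OF assms(1)] by auto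
  ultimately show "f -` S \<inter> space \<mu> \<in> sets \<mu>"
    using prob_measuresD(2)[OF assms(1)] by (metis mem_Collect_eq sigma_sets.Basic)
qed

text \<open>The continuous image of a compact space is bounded, and the measure is finite.\<close>

lemma continuous_map_integrable:
  assumes "compact_space X" "\<mu> \<in> prob_measures X" "continuous_map X euclideanreal f"
  shows "integrable \<mu> f"
proof -
  interpret prob_space \<mu>
    using assms prob_measuresD by blast
  have "compact (f ` topspace X)"
    using assms image_compactin by (fastforce simp: compact_space_def)
  then obtain B where "\<And>x. x \<in> topspace X \<Longrightarrow> norm (f x) \<le> B"
    using compact_imp_bounded bounded_iff by (metis imageI)
  then show ?thesis
    using assms continuous_map_borel_measurable prob_measuresD(3)[OF assms(2)]
    by (intro integrable_const_bound[where B = B]) auto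
qed

section \<open>Measures determined by their integrals\<close>

text \<open>Complements carry the equality over to open sets, which form an intersection-stable
  generator. The whole space is itself open and of finite measure, so a constant sequence serves as
  the exhaustion \<open>A\<close>.\<close>

lemma closed_measure_eqI:
  assumes \<mu>: "\<mu> \<in> prob_measures X" and \<nu>: "\<nu> \<in> prob_measures X"
    and eq: "\<And>C. closedin X C \<Longrightarrow> measure \<mu> C = measure \<nu> C"
  shows "\<mu> = \<nu>"
proof (rule measure_eqI_generator_eq[where E = "{U. openin X U}" and \<Omega> = "topspace X"
      and A = "\<lambda>_::nat. topspace X"])
  interpret \<mu>: prob_space \<mu> using \<mu> prob_measuresD by blast
  interpret \<nu>: prob_space \<nu> using \<nu> prob_measuresD by blast
  note [simp] = prob_measuresD(2,3)[OF \<mu>] prob_measuresD(2,3)[OF \<nu>]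
  fix U assume "U \<in> {U. openin X U}"
  then have U: "U \<in> sets \<mu>" "U \<in> sets \<nu>" "closedin X (topspace X - U)"
    by (auto intro: sigma_sets.Basic)
  then have "1 - measure \<mu> U = 1 - measure \<nu> U"
    using eq[of "topspace X - U"] \<mu>.prob_compl[of U] \<nu>.prob_compl[of U] by simp
  then show "emeasure \<mu> U = emeasure \<nu> U"
    by (simp add: \<mu>.emeasure_eq_measure \<nu>.emeasure_eq_measure)
next
  show "Int_stable {U. openin X U}"
    by (auto simp: Int_stable_def)
  show "emeasure \<mu> (topspace X) \<noteq> \<infinity>"
    using prob_measuresD[OF \<mu>] prob_space.emeasure_space_1 by fastforce
qed (use prob_measuresD[OF \<mu>] prob_measuresD[OF \<nu>] in \<open>auto dest: openin_subset\<close>)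

lemma prob_measures_eqI:
  assumes X: "metrizable_space X"
    and \<mu>: "\<mu> \<in> prob_measures X" and \<nu>: "\<nu> \<in> prob_measures X"
    and eq: "\<And>f. continuous_map X euclideanreal f \<Longrightarrow> (\<integral>x. f x \<partial>\<mu>) = (\<integral>x. f x \<partial>\<nu>)"
  shows "\<mu> = \<nu>"
proof (rule closed_measure_eqI[OF \<mu> \<nu>])
  fix C assume C: "closedin X C"
  obtain U where U: "\<And>n::nat. openin X (U n)" "\<And>n. U (Suc n) \<subseteq> U n" "\<Inter> (range U) = C"
    using closed_imp_gdelta_in[OF X C] unfolding gdelta_in_descending by blast
  have "\<exists>f. continuous_map X (top_of_set {0..1::real}) f \<and> f ` (topspace X - U n) \<subseteq> {0} \<and> f ` C \<subseteq> {1}" for n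
  proof -
    have "disjnt (topspace X - U n) C"
      using U(3) by (auto simp: disjnt_def)
    then show ?thesis
      using Urysohn_lemma[OF metrizable_imp_normal_space[OF X], of "topspace X - U n" C 0 1] U(1) C
      by (metis closedin_topspace openin_closedin_eq closedin_diff zero_le_one)
  qed
  then obtain f where f: "\<And>n. continuous_map X (top_of_set {0..1::real}) (f n)"
    "\<And>n. f n ` (topspace X - U n) \<subseteq> {0}" "\<And>n. f n ` C \<subseteq> {1}"
    by metis
  have fc: "continuous_map X euclideanreal (f n)" for n
    using f(1) continuous_map_in_subtopology by blast
  have f01: "f n x \<in> {0..1}" if "x \<in> topspace X" for n x
    using f(1)[of n] that by (auto simp: continuous_map_in_subtopology)
  \<comment> \<open>On \<open>C\<close> every \<open>f n\<close> is 1. A point off \<open>C\<close>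
    leaves some \<open>U N\<close>, hence all later \<open>U n\<close> because they decrease, so its
    values are eventually 0.\<close>
  have lim: "(\<lambda>n. f n x) \<longlonglongrightarrow> indicat_real C x" if x: "x \<in> topspace X" for x
  proof (cases "x \<in> C")
    case True
    then show ?thesis using f(3) by (auto simp: image_subset_iff)
  next
    case False
    then obtain N where "x \<notin> U N"
      using U(3) by blast
    then have "x \<notin> U n" if "n \<ge> N" for n
      using lift_Suc_antimono_le[of U N n] U(2) that by blast
    then have "f n x = 0" if "n \<ge> N" for n
      using f(2)[of n] x that by blast
    then show ?thesis
      using False by (auto intro!: tendsto_eventually eventually_sequentiallyI[of N])
  qed
  have int: "(\<lambda>n. \<integral>x. f n x \<partial>\<rho>) \<longlonglongrightarrow> measure \<rho> C" if \<rho>: "\<rho> \<in> prob_measures X" for \<rho>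
  proof -
    interpret prob_space \<rho> using \<rho> prob_measuresD by blast
    \<comment> \<open>The generators are open sets, so \<open>C\<close> is reached as the complement
      of its open complement.\<close>
    have "topspace X - (topspace X - C) \<in> sets \<rho>"
      using C prob_measuresD[OF \<rho>] by (metis closedin_def mem_Collect_eq sigma_sets.Basic sets.compl_sets)
    then have [measurable]: "C \<in> sets \<rho>"
      using closedin_subset[OF C] by (simp add: double_diff)
    have "(\<lambda>n. \<integral>x. f n x \<partial>\<rho>) \<longlonglongrightarrow> (\<integral>x. indicat_real C x \<partial>\<rho>)"
      using lim f01 continuous_map_borel_measurable[OF \<rho> fc]
      by (intro integral_dominated_convergence[where w = "\<lambda>_. 1"])
        (auto simp: prob_measuresD(3)[OF \<rho>])
    then show ?thesis
      using \<open>C \<in> sets \<rho>\<close> by simp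
  qed
  show "measure \<mu> C = measure \<nu> C"
    using LIMSEQ_unique[OF int[OF \<mu>]] int[OF \<nu>] eq[OF fc] by simp
qed

section \<open>The vague topology as a pullback from sequence space\<close>

text \<open>Total mass one makes the bound the same for every \<mu>, so one \<open>g n\<close> can
  replace \<open>f\<close> under all measures at once.\<close>

lemma integral_diff_le_uniform:
  assumes "compact_space X" "\<mu> \<in> prob_measures X"
    and "continuous_map X euclideanreal f" "continuous_map X euclideanreal g"
    and close: "\<And>x. x \<in> topspace X \<Longrightarrow> \<bar>f x - g x\<bar> \<le> \<epsilon>"
  shows "\<bar>(\<integral>x. f x \<partial>\<mu>) - (\<integral>x. g x \<partial>\<mu>)\<bar> \<le> \<epsilon>"
proof -
  interpret prob_space \<mu> using assms prob_measuresD by blast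
  have int: "integrable \<mu> f" "integrable \<mu> g"
    using assms continuous_map_integrable by blast+
  have "\<bar>(\<integral>x. f x \<partial>\<mu>) - (\<integral>x. g x \<partial>\<mu>)\<bar> = \<bar>\<integral>x. f x - g x \<partial>\<mu>\<bar>"
    using int by simp
  also have "\<dots> \<le> (\<integral>x. \<bar>f x - g x\<bar> \<partial>\<mu>)"
    by (rule integral_abs_bound)
  also have "\<dots> \<le> (\<integral>x. \<epsilon> \<partial>\<mu>)"
    using int close prob_measuresD(3)[OF assms(2)] by (intro integral_mono) auto
  finally show ?thesis
    by (simp add: prob_space)
qed

text \<open>Each functional given by a continuous \<open>f\<close> is a uniform limit of those given
  by the \<open>g n\<close>, so countably many coordinates generate the same topology. The
  unsimplified membership \<open>f \<in> {f. ...}\<close> matches what unfolding the test function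
  classes produces.\<close>

lemma weak_topology_eq_pullback:
  fixes g :: "nat \<Rightarrow> 'a \<Rightarrow> real"
  assumes X: "compact_space X"
    and g: "\<And>n. continuous_map X euclideanreal (g n)"
    and dense: "\<And>f \<epsilon>. continuous_map X euclideanreal f \<Longrightarrow> \<epsilon> > 0 \<Longrightarrow>
       \<exists>n. \<forall>x\<in>topspace X. \<bar>g n x - f x\<bar> \<le> \<epsilon>"
  shows "topology_generated_by {vague_nbhd X \<nu> f \<epsilon> | \<nu> f \<epsilon>. \<nu> \<in> prob_measures X \<and>
           f \<in> {f. continuous_map X euclideanreal f} \<and> \<epsilon> > 0}
    = pullback_topology (prob_measures X) (\<lambda>\<mu> n. \<integral>x. g n x \<partial>\<mu>) euclidean"
    (is "topology_generated_by ?S = pullback_topology ?A ?\<Phi> euclidean")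
proof -
  let ?T = "topology_generated_by ?S" and ?P = "pullback_topology ?A ?\<Phi> euclidean"
  have top: "topspace ?T = ?A"
    unfolding topology_generated_by_topspace by (rule Union_vague_nbhd) simp
  have T_le_P: "openin ?P W" if openW: "openin ?T W" for W
  proof -
    have "openin ?P V" if V_in: "V \<in> ?S" for V
    proof -
      obtain \<nu> f \<epsilon> where V: "V = vague_nbhd X \<nu> f \<epsilon>" and \<nu>: "\<nu> \<in> ?A"
        and f: "continuous_map X euclideanreal f" and "\<epsilon> > 0"
        using V_in by blast
      have "\<exists>W. openin ?P W \<and> \<rho> \<in> W \<and> W \<subseteq> V" if "\<rho> \<in> V" for \<rho>
      proof -
        define c where "c = \<bar>(\<integral>x. f x \<partial>\<rho>) - (\<integral>x. f x \<partial>\<nu>)\<bar>"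
        \<comment> \<open>The slack of \<rho> inside \<open>V\<close> is split in three: exchanging
          \<open>f\<close> for \<open>g n\<close> under \<rho>, the same under \<sigma>, and the
          distance between the two integrals of \<open>g n\<close>.\<close>
        define \<delta> where "\<delta> = (\<epsilon> - c) / 3"
        have \<rho>: "\<rho> \<in> ?A" and "c < \<epsilon>"
          using \<open>\<rho> \<in> V\<close> by (auto simp: V vague_nbhd_def c_def)
        then have "\<delta> > 0" and \<delta>_eq: "3 * \<delta> + c = \<epsilon>"
          by (simp_all add: \<delta>_def diff_divide_distrib)
        obtain n where n: "\<And>x. x \<in> topspace X \<Longrightarrow> \<bar>g n x - f x\<bar> \<le> \<delta>"
          using dense[OF f \<open>\<delta> > 0\<close>] by blast
        note approx = integral_diff_le_uniform[OF X _ g f n]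
        \<comment> \<open>A cylinder: only coordinate \<open>n\<close> of the sequence is
          constrained.\<close>
        let ?W = "?\<Phi> -` ((\<lambda>s. s n) -` ball (\<integral>x. g n x \<partial>\<rho>) \<delta>) \<inter> ?A"
        have "open ((\<lambda>s. s n) -` ball (\<integral>x. g n x \<partial>\<rho>) \<delta> :: (nat \<Rightarrow> real) set)"
          by (rule open_vimage) (auto intro: continuous_on_product_coordinates)
        then have "openin ?P ?W"
          unfolding openin_pullback_topology using open_openin by blast
        moreover have "\<rho> \<in> ?W"
          using \<rho> \<open>\<delta> > 0\<close> by simp
        moreover have "?W \<subseteq> V"
        proof
          fix \<sigma> assume "\<sigma> \<in> ?W"
          then have "\<sigma> \<in> ?A" "\<bar>(\<integral>x. g n x \<partial>\<rho>) - (\<integral>x. g n x \<partial>\<sigma>)\<bar> < \<delta>"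
            by (auto simp: dist_real_def)
          with approx[OF \<rho>] approx[OF \<open>\<sigma> \<in> ?A\<close>]
          have "\<bar>(\<integral>x. f x \<partial>\<sigma>) - (\<integral>x. f x \<partial>\<rho>)\<bar> < 3 * \<delta>"
            by linarith
          then have "\<bar>(\<integral>x. f x \<partial>\<sigma>) - (\<integral>x. f x \<partial>\<nu>)\<bar> < \<epsilon>"
            using \<delta>_eq unfolding c_def by linarith
          then show "\<sigma> \<in> V"
            using \<open>\<sigma> \<in> ?A\<close> by (simp add: V vague_nbhd_def)
        qed
        ultimately show ?thesis by blast
      qed
      then show ?thesis
        by (subst openin_subopen) blast
    qed
    then show ?thesis
      \<comment> \<open>Openness of the subbasic sets suffices, as the generated topology is the
        coarsest one containing them.\<close>
      by (rule generate_topology_on_coarsest[OF istopology_openin _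
            openin_topology_generated_by[OF openW]])
  qed
  \<comment> \<open>For the reverse inclusion it is enough that \<open>?\<Phi>\<close> is
    continuous, which in a product is checked coordinatewise.\<close>
  have "continuous_map ?T euclideanreal (\<lambda>\<mu>. \<integral>x. g n x \<partial>\<mu>)" for n
  proof -
    have "openin ?T {\<mu> \<in> ?A. (\<integral>x. g n x \<partial>\<mu>) \<in> U}" (is "openin ?T ?V") if "open U" for U
    proof -
      have "\<exists>W. openin ?T W \<and> \<nu> \<in> W \<and> W \<subseteq> ?V" if "\<nu> \<in> ?V" for \<nu>
      proof -
        obtain \<epsilon> where \<epsilon>: "\<epsilon> > 0" "ball (\<integral>x. g n x \<partial>\<nu>) \<epsilon> \<subseteq> U"
          using \<open>open U\<close> \<open>\<nu> \<in> ?V\<close> by (auto elim: openE)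
        \<comment> \<open>Centring at \<nu> itself makes this subbasic set exactly the preimage of
          the \<epsilon>-ball around the integral of \<open>g n\<close> under \<nu>.\<close>
        have "openin ?T (vague_nbhd X \<nu> (g n) \<epsilon>)"
          using \<epsilon>(1) \<open>\<nu> \<in> ?V\<close> g by (intro topology_generated_by_Basis) blast
        moreover have "vague_nbhd X \<nu> (g n) \<epsilon> \<subseteq> ?V"
          using \<epsilon>(2) by (auto simp: vague_nbhd_def dist_real_def subset_iff abs_minus_commute)
        ultimately show ?thesis
          using in_vague_nbhd \<epsilon>(1) \<open>\<nu> \<in> ?V\<close> by blast
      qed
      then show ?thesis
        by (subst openin_subopen) blast
    qed
    then show ?thesis
      unfolding continuous_map_def[of ?T] top by simp
  qed
  then have "continuous_map ?T (product_topology (\<lambda>_. euclideanreal) UNIV) ?\<Phi>"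
    by (simp add: continuous_map_componentwise_UNIV)
  then have cont: "continuous_map ?T euclidean ?\<Phi>"
    by (simp add: euclidean_product_topology)
  have P_le_T: "openin ?T W" if openW: "openin ?P W" for W
  proof -
    obtain U where U: "open U" and W: "W = ?\<Phi> -` U \<inter> ?A"
      using openW by (auto simp: openin_pullback_topology)
    have "openin ?T {\<mu> \<in> topspace ?T. ?\<Phi> \<mu> \<in> U}"
      using U by (intro openin_continuous_map_preimage[OF cont]) simp
    moreover have "{\<mu> \<in> topspace ?T. ?\<Phi> \<mu> \<in> U} = W"
      unfolding W top by blast
    ultimately show ?thesis by simp
  qed
  show ?thesis
    unfolding topology_eq using T_le_P P_le_T by blast
qed

section \<open>Separability and metrizability of the vague topologies\<close>

theorem theorem2p5:
  fixes X :: "'a set" and d :: "'a \<Rightarrow> 'a \<Rightarrow> real"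
  assumes "Metric_space X d"
    and "compact_space (Metric_space.mtopology X d)"
  shows "separable_space (vague1_topology (Metric_space.mtopology X d)) \<and>
         metrizable_space (vague1_topology (Metric_space.mtopology X d)) \<and>
         separable_space (vague2_topology (Metric_space.mtopology X d)) \<and>
         metrizable_space (vague2_topology (Metric_space.mtopology X d))"
proof -
  interpret Metric_space X d by fact
  let ?A = "prob_measures mtopology"
  obtain G where G: "countable G" "G \<subseteq> {g. continuous_map mtopology euclideanreal g}"
    and dense: "\<And>f \<epsilon>. continuous_map mtopology euclideanreal f \<Longrightarrow> \<epsilon> > 0 \<Longrightarrow>
       \<exists>g\<in>G. \<forall>x\<in>X. \<bar>g x - f x\<bar> \<le> \<epsilon>"
    using countable_uniformly_dense_continuous[OF assms(2)] by blast
  \<comment> \<open>Nonemptiness is what lets \<open>from_nat_into\<close> enumerate exactly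
    \<open>G\<close>; approximating the zero function provides an element.\<close>
  have "G \<noteq> {}"
    using dense[of "\<lambda>_. 0" 1] by auto
  define g where "g = from_nat_into G"
  have range: "range g = G"
    using G(1) \<open>G \<noteq> {}\<close> by (simp add: g_def)
  define \<Phi> where "\<Phi> \<mu> n = (\<integral>x. g n x \<partial>\<mu>)" for \<mu> n
  have gc: "continuous_map mtopology euclideanreal (g n)" for n
    using G(2) range by blast
  have gd: "\<exists>n. \<forall>x\<in>topspace mtopology. \<bar>g n x - f x\<bar> \<le> \<epsilon>"
    if "continuous_map mtopology euclideanreal f" "\<epsilon> > 0" for f \<epsilon>
    using dense[OF that] range by (metis rangeE topspace_mtopology)
  have "inj_on \<Phi> ?A"
  proof (rule inj_onI)
    fix \<mu> \<nu> assume \<mu>: "\<mu> \<in> ?A" and \<nu>: "\<nu> \<in> ?A" and "\<Phi> \<mu> = \<Phi> \<nu>"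
    then have eq: "(\<integral>x. g n x \<partial>\<mu>) = (\<integral>x. g n x \<partial>\<nu>)" for n
      by (metis \<Phi>_def)
    show "\<mu> = \<nu>"
    proof (rule prob_measures_eqI[OF metrizable_space_mtopology \<mu> \<nu>])
      fix f assume f: "continuous_map mtopology euclideanreal f"
      \<comment> \<open>Agreement on the dense family extends to \<open>f\<close>: replacing
        \<open>f\<close> by \<open>g n\<close> costs half of \<epsilon> under each measure.\<close>
      have "\<bar>(\<integral>x. f x \<partial>\<mu>) - (\<integral>x. f x \<partial>\<nu>)\<bar> \<le> \<epsilon>" if "\<epsilon> > 0" for \<epsilon>
      proof -
        obtain n where n: "\<And>x. x \<in> topspace mtopology \<Longrightarrow> \<bar>g n x - f x\<bar> \<le> \<epsilon> / 2"
          using gd[OF f, of "\<epsilon> / 2"] \<open>\<epsilon> > 0\<close> by auto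
        note approx = integral_diff_le_uniform[OF assms(2) _ gc f n]
        show ?thesis
          using approx[OF \<mu>] approx[OF \<nu>] eq[of n] by linarith
      qed
      then show "(\<integral>x. f x \<partial>\<mu>) = (\<integral>x. f x \<partial>\<nu>)"
        using field_le_epsilon[of "\<bar>(\<integral>x. f x \<partial>\<mu>) - (\<integral>x. f x \<partial>\<nu>)\<bar>" 0] by simp
    qed
  qed
  then have emb: "embedding_map (pullback_topology ?A \<Phi> euclidean) euclidean \<Phi>"
    by (intro embedding_map_pullback_topology) auto
  have "vague1_topology mtopology = pullback_topology ?A \<Phi> euclidean"
    "vague2_topology mtopology = pullback_topology ?A \<Phi> euclidean"
    using weak_topology_eq_pullback[OF assms(2) gc gd]
    unfolding vague1_topology_def vague2_topology_def C_sc_compact_space[OF assms(2)]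
      C_0_compact_space[OF assms(2)] \<Phi>_def by blast+
  then show ?thesis
    using embedding_map_separable_metrizable[OF emb] by simp
qed

end
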